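(* There exists a constant $c>0$ such that for arbitrarily large integers $N$ there exist an integer $M$ and a partial sign matrix $A\in\{-1,1,*\}^{M\times N}$ with $\mathrm{VC}(A)=1$ and $$\operatorname{coind}_{\mathbb{Z}_2}(S(A))\ \ge\ c\,\frac{\log^2 N}{\log\log N}.$$
   Context: VC dimension. For $A\in\{-1,1,*\}^{M\times N}$, $\mathrm{VC}(A)$ is the largest $d$ for which there is a set of columns $S\subseteq[N]$ with $|S|=d$ such that every sign pattern $P\in\{-1,1\}^S$ appears as the restriction to $S$ of some row of $A$. Sign complex. For each row $r$ of $A$, let $\sigma_r^+=\{i^+: r_i=+1\}\cup\{i^-: r_i=-1\}$ and $\sigma_r^-=\{i^-: r_i=+1\}\cup\{i^+: r_i=-1\}$, subsets of $\{1^+,1^-,\dots,N^+,N^-\}$. The sign complex $S(A)$ is the abstract simplicial complex whose simplices are all subsets of $\sigma_r^+$ or $\sigma_r^-$ over all rows $r$. The involution $i^+\leftrightarrow i^-$ is a free simplicial $\mathbb{Z}_2$-action on $S(A)$, inducing a free action on the geometric realization $|S(A)|$. Coindex. For a free $\mathbb{Z}_2$-complex $K$, $\operatorname{coind}_{\mathbb{Z}_2}(K)$ is the maximum $d\ge 0$ for which there is a continuous $\mathbb{Z}_2$-equivariant map $\mathbb{S}^d\to|K|$, where $\mathbb{S}^d$ carries the antipodal action. *)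

theory Defs
  imports
    "HOL-Analysis.Abstract_Euclidean_Space"
    "HOL-Library.Extended_Real"
    "Jordan_Normal_Form.Matrix"
begin

datatype sign = Neg | Pos

fun opp :: "sign \<Rightarrow> sign" where
  "opp Neg = Pos"
| "opp Pos = Neg"

lemma opp_opp [simp]: "opp (opp s) = s"
  by (cases s) auto

lemma opp_neq [simp]: "opp s \<noteq> s" "s \<noteq> opp s"
  by (cases s; simp)+

text \<open>A partial sign matrix is a matrix with entries of type \<^typ>\<open>sign option\<close>, where
  \<^term>\<open>None\<close> stands for the entry \<open>*\<close>. Rows and columns are numbered from 0.\<close>

definition shattered :: "sign option mat \<Rightarrow> nat set \<Rightarrow> bool" where
  "shattered A S \<longleftrightarrow>
     S \<subseteq> {..<dim_col A} \<and>
     (\<forall>P :: nat \<Rightarrow> sign. \<exists>r<dim_row A. \<forall>j\<in>S. A $$ (r, j) = Some (P j))"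

text \<open>If the matrix has at least one row then the empty set is shattered, so that the maximum below
  is taken over a finite nonempty set.\<close>

definition VC :: "sign option mat \<Rightarrow> nat" where
  "VC A = Max {card S | S. shattered A S}"

text \<open>The vertices \<open>i\<^sup>+\<close> and \<open>i\<^sup>-\<close> are the pairs \<open>(i, Pos)\<close> and \<open>(i, Neg)\<close>.\<close>

definition flip :: "nat \<times> sign \<Rightarrow> nat \<times> sign" where
  "flip v = (fst v, opp (snd v))"

definition row_plus :: "sign option mat \<Rightarrow> nat \<Rightarrow> (nat \<times> sign) set" where
  "row_plus A r =
     {(i, Pos) | i. i < dim_col A \<and> A $$ (r, i) = Some Pos} \<union>
     {(i, Neg) | i. i < dim_col A \<and> A $$ (r, i) = Some Neg}"

definition row_minus :: "sign option mat \<Rightarrow> nat \<Rightarrow> (nat \<times> sign) set" where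
  "row_minus A r =
     {(i, Neg) | i. i < dim_col A \<and> A $$ (r, i) = Some Pos} \<union>
     {(i, Pos) | i. i < dim_col A \<and> A $$ (r, i) = Some Neg}"

definition sign_complex :: "sign option mat \<Rightarrow> (nat \<times> sign) set set" where
  "sign_complex A = {\<sigma>. \<exists>r<dim_row A. \<sigma> \<subseteq> row_plus A r \<or> \<sigma> \<subseteq> row_minus A r}"

text \<open>Geometric realization of a finite abstract simplicial complex in barycentric coordinates.
  Points have coordinate sum 1, so the empty simplex contributes none. The subspace topology of
  the product is the usual topology of the realization because the complex is finite.\<close>

definition realization :: "'v set set \<Rightarrow> ('v \<Rightarrow> real) topology" where
  "realization K = subtopology (powertop_real UNIV)
     {x. (\<forall>v. 0 \<le> x v) \<and> {v. x v \<noteq> 0} \<in> K \<and> (\<Sum>v | x v \<noteq> 0. x v) = 1}"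

text \<open>A simplicial involution \<open>\<nu>\<close> acts on barycentric coordinates by \<open>x \<mapsto> x \<circ> \<nu>\<close>, since \<open>\<nu>\<close> is its
  own inverse.\<close>

definition equivariant_sphere_map ::
    "nat \<Rightarrow> 'v set set \<Rightarrow> ('v \<Rightarrow> 'v) \<Rightarrow> ((nat \<Rightarrow> real) \<Rightarrow> 'v \<Rightarrow> real) \<Rightarrow> bool" where
  "equivariant_sphere_map d K \<nu> f \<longleftrightarrow>
     continuous_map (nsphere d) (realization K) f \<and>
     (\<forall>x\<in>topspace (nsphere d). f (\<lambda>i. - x i) = f x \<circ> \<nu>)"

text \<open>The coindex as a supremum in the extended reals. By the Borsuk--Ulam theorem, the dimensions
  occurring here are bounded for a finite free complex, so the supremum is the maximum as soon as
  the complex has a vertex; it is \<open>-\<infinity>\<close> if no equivariant map exists.\<close>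

definition coind :: "'v set set \<Rightarrow> ('v \<Rightarrow> 'v) \<Rightarrow> ereal" where
  "coind K \<nu> = (SUP d \<in> {d. \<exists>f. equivariant_sphere_map d K \<nu> f}. ereal (real d))"

lemma flip_flip [simp]: "flip (flip v) = v"
  by (simp add: flip_def)

lemma sign_complex_subset: "\<sigma> \<in> sign_complex A \<Longrightarrow> \<tau> \<subseteq> \<sigma> \<Longrightarrow> \<tau> \<in> sign_complex A"
  unfolding sign_complex_def by blast

lemma flip_row_plus: "flip ` row_plus A r = row_minus A r"
  by (force simp: row_plus_def row_minus_def flip_def)

lemma flip_row_minus: "flip ` row_minus A r = row_plus A r"
  by (force simp: row_plus_def row_minus_def flip_def)

lemma flip_sign_complex: "\<sigma> \<in> sign_complex A \<Longrightarrow> flip ` \<sigma> \<in> sign_complex A"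
  unfolding sign_complex_def using flip_row_plus flip_row_minus by (blast dest: image_mono)

text \<open>No simplex meets its image under the involution, hence the action is free.\<close>

lemma sign_complex_free:
  assumes "\<sigma> \<in> sign_complex A"
  shows "\<sigma> \<inter> flip ` \<sigma> = {}"
proof -
  obtain r where "\<sigma> \<subseteq> row_plus A r \<or> \<sigma> \<subseteq> row_minus A r"
    using assms by (auto simp: sign_complex_def)
  moreover have "row_plus A r \<inter> row_minus A r = {}"
    by (auto simp: row_plus_def row_minus_def)
  ultimately show ?thesis
    using flip_row_plus[of A r] flip_row_minus[of A r] by blast
qed

end

theory Submission
  imports Defs
begin

text \<open>Suppose that nonnegative continuous functions \<open>\<phi> a\<close> on the sphere, one for each label \<open>a\<close> of a
  finite set, have no common zero, and that no two labels, equal or not, are active (that is, have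
  positive \<open>\<phi>\<close>) both at a common point \<open>x\<close> and at a pair of antipodal points \<open>y\<close>, \<open>- y\<close>. Take the labels as columns.
  Each point \<open>x\<close> gives a row: the entry in column \<open>a\<close> is \<open>+\<close> if \<open>a\<close> is active at \<open>x\<close>, \<open>-\<close> if it is
  active at \<open>- x\<close>, and \<open>*\<close> otherwise. Two columns never show both the patterns \<open>(+,+)\<close> and \<open>(+,-)\<close>,
  so the VC dimension is 1, while the normalised functions \<open>\<phi>\<close> are the barycentric coordinates of an
  equivariant map from the sphere to the sign complex. This is \<open>partial_sign_matrix_of_sphere_cover\<close>.

  It remains to find few such functions on a sphere of large dimension. Split the \<open>r * k\<close>
  coordinates into \<open>r\<close> blocks of length \<open>k\<close>. A label \<open>(b, g, h)\<close> consists of a block \<open>b\<close>, signs \<open>g\<close>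
  for all coordinates of this one block, and a function \<open>h\<close> that chooses one coordinate, with a
  sign, in each of the blocks. It is active at \<open>x\<close> if block \<open>b\<close> of \<open>x\<close> is not small, if \<open>g\<close> is
  wrong only at tiny coordinates, and if in every block that is not small the coordinate chosen by
  \<open>h\<close> is not tiny and has the chosen sign. If \<open>(b, g, h)\<close> and \<open>(b', g', h')\<close> are both active at \<open>x\<close>
  then \<open>h' b\<close> is a coordinate of block \<open>b\<close> that is not tiny, so \<open>g\<close> has there the sign chosen by \<open>h'\<close>.
  If the first is active at \<open>y\<close> and the second at \<open>- y\<close>, then \<open>g\<close> has there the opposite sign. Both
  cannot happen (\<open>bump_separated\<close>).

  A full sign vector is thus stored for one block only, and only one coordinate for each of the others.
  There are \<open>N = r * 2 ^ k * (2 * k) ^ r\<close> labels, and the sphere has dimension \<open>r * k - 1\<close>. The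
  factors \<open>2 ^ k\<close> and \<open>(2 * k) ^ r\<close> balance when \<open>k\<close> is about \<open>r * log r\<close>. Then \<open>ln N\<close> is of order \<open>k\<close>
  and \<open>ln (ln N)\<close> of order \<open>log r\<close>, so that \<open>(ln N)\<^sup>2 / ln (ln N)\<close> is of order \<open>r * k\<close>.\<close>

section \<open>From functions on the sphere to a matrix of VC dimension 1\<close>

lemma UNIV_sign: "(UNIV :: sign set) = {Neg, Pos}"
  using sign.exhaust by auto

lemma continuous_map_nsphere_antipodal:
  "continuous_map (nsphere d) (nsphere d) (\<lambda>x i. - x i)"
  unfolding nsphere continuous_map_in_subtopology continuous_map_componentwise_UNIV
  by (auto intro!: continuous_intros continuous_map_from_subtopology
      simp: continuous_map_product_projection)

lemma nsphere_antipodal: "x \<in> topspace (nsphere d) \<Longrightarrow> (\<lambda>i. - x i) \<in> topspace (nsphere d)"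
  by (simp add: nsphere)

text \<open>The hypothesis \<open>separated\<close> with \<open>a = b\<close> also says that no label is active at antipodal points,
  so the sign patterns that serve as rows are well defined.\<close>

lemma partial_sign_matrix_of_sphere_cover:
  fixes \<phi> :: "'a \<Rightarrow> (nat \<Rightarrow> real) \<Rightarrow> real" and d :: nat
  defines "S \<equiv> topspace (nsphere d)"
  assumes fin: "finite I"
    and cont: "\<And>a. a \<in> I \<Longrightarrow> continuous_map (nsphere d) euclideanreal (\<phi> a)"
    and nonneg: "\<And>a x. a \<in> I \<Longrightarrow> x \<in> S \<Longrightarrow> 0 \<le> \<phi> a x"
    and cover: "\<And>x. x \<in> S \<Longrightarrow> \<exists>a\<in>I. \<phi> a x > 0"
    and separated: "\<And>a b x y. \<lbrakk>a \<in> I; b \<in> I; x \<in> S; y \<in> S; \<phi> a x > 0; \<phi> b x > 0;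
        \<phi> a y > 0; \<phi> b (\<lambda>i. - y i) > 0\<rbrakk> \<Longrightarrow> False"
  shows "\<exists>M (A :: sign option mat). A \<in> carrier_mat M (card I) \<and> VC A = 1 \<and>
           coind (sign_complex A) flip \<ge> ereal (real d)"
proof -
  define N where "N = card I"
  obtain e where e: "bij_betw e {..<N} I"
    using ex_bij_betw_nat_finite[OF fin] by (auto simp: N_def atLeast0LessThan)
  have eI: "e i \<in> I" if "i < N" for i
    using e that by (auto simp: bij_betw_def)
  define signed where "signed s x = (if s = Pos then x else (\<lambda>i. - x i))" for s and x :: "nat \<Rightarrow> real"
  have signed_S: "signed s x \<in> S" if "x \<in> S" for s x
    using that nsphere_antipodal by (auto simp: signed_def S_def)
  have signed_neg: "signed s (\<lambda>i. - x i) = signed (opp s) x" for s x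
    by (cases s) (auto simp: signed_def)
  define w where "w x v = (if fst v < N then \<phi> (e (fst v)) (signed (snd v) x) else 0)" for x v
  have w_nonneg: "0 \<le> w x v" if "x \<in> S" for x v
    using that by (simp add: w_def nonneg eI signed_S)
  have w_neg: "w (\<lambda>i. - x i) v = w x (flip v)" for x v
    by (simp add: w_def signed_neg flip_def)
  have w_cont: "continuous_map (nsphere d) euclideanreal (\<lambda>x. w x v)" for v
  proof (cases "fst v < N")
    case True
    have "continuous_map (nsphere d) (nsphere d) (signed (snd v))"
      using continuous_map_nsphere_antipodal by (auto simp: signed_def[abs_def])
    from continuous_map_compose[OF this cont[OF eI[OF True]]] show ?thesis
      using True by (simp add: w_def o_def)
  qed (simp add: w_def)
  (* The vertex (i, s) is active at x if w x (i, s) > 0. This is the separation hypothesis for signed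
     labels: if s and t differ, the points x and y exchange their roles. *)
  have incompatible: False
    if "x \<in> S" "y \<in> S" "w x (i, s) > 0" "w x (j, t) > 0" "w y (i, s) > 0" "w y (j, opp t) > 0"
    for x y i j s t
  proof -
    have ij: "i < N" "j < N"
      using that by (auto simp: w_def split: if_splits)
    have pos: "\<phi> (e i) (signed s x) > 0" "\<phi> (e j) (signed t x) > 0"
      "\<phi> (e i) (signed s y) > 0" "\<phi> (e j) (signed (opp t) y) > 0"
      using that ij by (auto simp: w_def)
    have neg: "signed (opp u) z = (\<lambda>i. - signed u z i)" for u and z :: "nat \<Rightarrow> real"
      by (cases u) (auto simp: signed_def)
    show False
    proof (cases "s = t")
      case True
      then show False
        using separated[of "e i" "e j" "signed s x" "signed s y"] pos ij that(1,2)
        by (simp add: eI signed_S neg)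
    next
      case False
      then have t: "t = opp s"
        by (cases s; cases t) auto
      then show False
        using separated[of "e i" "e j" "signed s y" "signed s x"] pos ij that(1,2)
        by (simp add: eI signed_S neg)
    qed
  qed
  define pat where "pat x i =
      (if w x (i, Pos) > 0 then Some Pos else if w x (i, Neg) > 0 then Some Neg else None)" for x i
  have pat: "pat x i = Some s \<longleftrightarrow> w x (i, s) > 0" if "x \<in> S" for x i s
    using incompatible[OF that that, of i Pos i Pos] by (cases s) (auto simp: pat_def)

  (* The sphere has infinitely many points but only finitely many patterns. As x and - x have
     opposite patterns, the rows come in antipodal pairs; this makes a single column shattered. *)
  let ?R = "(\<lambda>x. map (pat x) [0..<N]) ` S"
  have "finite ?R"
  proof (rule finite_subset)
    show "?R \<subseteq> {l. set l \<subseteq> insert None (Some ` {Neg, Pos}) \<and> length l = N}"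
      by (auto simp: pat_def)
  qed (rule finite_lists_length_eq, simp)
  then obtain xs where xs: "set xs = ?R"
    using finite_list by blast
  define A where "A = mat (length xs) N (\<lambda>(r, i). xs ! r ! i)"
  have A: "A \<in> carrier_mat (length xs) N" "dim_row A = length xs" "dim_col A = N"
    by (auto simp: A_def)
  have point_of_row: "\<exists>x\<in>S. \<forall>i<N. A $$ (r, i) = pat x i" if "r < length xs" for r
  proof -
    have "xs ! r \<in> ?R"
      using that xs nth_mem by blast
    then show ?thesis
      using that by (auto simp: A_def)
  qed
  have row_of_point: "\<exists>r<length xs. \<forall>i<N. A $$ (r, i) = pat x i" if "x \<in> S" for x
  proof -
    have "map (pat x) [0..<N] \<in> set xs"
      using that xs by blast
    then show ?thesis
      by (auto simp: A_def in_set_conv_nth)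
  qed

  have "VC A = 1"
  proof -
    obtain x where x: "x \<in> S"
      using in_topspace_nsphere S_def by blast
    obtain a where "a \<in> I" "\<phi> a x > 0"
      using cover x by blast
    then obtain i where i: "i < N" "e i = a"
      using e by (auto simp: bij_betw_def)
    have "w x (i, Pos) > 0"
      using i \<open>\<phi> a x > 0\<close> by (simp add: w_def signed_def)
    moreover from this have "w (\<lambda>i. - x i) (i, Neg) > 0"
      by (simp add: w_neg flip_def)
    moreover have x': "(\<lambda>i. - x i) \<in> S"
      using x nsphere_antipodal S_def by blast
    ultimately have "\<exists>y\<in>S. pat y i = Some s" for s
      using x pat by (cases s) blast+
    then have "\<exists>r<length xs. A $$ (r, i) = Some s" for s
      using row_of_point i by metis
    then have single: "shattered A {i}"
      using i by (simp add: shattered_def A)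
    have le1: "card T \<le> 1" if T: "shattered A T" for T
    proof (rule ccontr)
      assume "\<not> card T \<le> 1"
      then obtain i j where ij: "i \<in> T" "j \<in> T" "i \<noteq> j"
        by (metis card_le_Suc0_iff_eq One_nat_def card.infinite zero_le)
      have "T \<subseteq> {..<N}"
        using T by (simp add: shattered_def A)
      then have N: "i < N" "j < N"
        using ij by auto
      have "\<exists>x\<in>S. pat x i = Some Pos \<and> pat x j = Some s" for s
      proof -
        obtain r where r: "r < length xs" "\<forall>k\<in>T. A $$ (r, k) = Some (if k = i then Pos else s)"
          using T[unfolded shattered_def A(2), THEN conjunct2, rule_format,
              of "\<lambda>k. if k = i then Pos else s"] by blast
        then obtain x where "x \<in> S" "\<forall>k<N. A $$ (r, k) = pat x k"
          using point_of_row by blast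
        then show ?thesis
          using r(2) ij N by (intro bexI[of _ x]) force+
      qed
      then obtain x y where "x \<in> S" "y \<in> S" "pat x i = Some Pos" "pat x j = Some Pos"
        "pat y i = Some Pos" "pat y j = Some Neg"
        by meson
      then show False
        using incompatible[of x y i Pos j Pos] by (simp add: pat)
    qed
    have "finite {card T | T. shattered A T}"
      by (rule finite_subset[of _ "{..1}"]) (use le1 in auto)
    moreover have "1 \<in> {card T | T. shattered A T}"
      using single by force
    ultimately show ?thesis
      unfolding VC_def using le1 by (intro Max_eqI) auto
  qed
  moreover have "\<exists>f. equivariant_sphere_map d (sign_complex A) flip f"
  proof -
    define V where "V = {..<N} \<times> (UNIV :: sign set)"
    have finV: "finite V"
      by (simp add: V_def UNIV_sign)
    define Z where "Z x = (\<Sum>v\<in>V. w x v)" for x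
    have Z_pos: "Z x > 0" if "x \<in> S" for x
    proof -
      obtain a where "a \<in> I" "\<phi> a x > 0"
        using cover \<open>x \<in> S\<close> by blast
      then obtain i where i: "i < N" "e i = a"
        using e by (auto simp: bij_betw_def)
      have "w x (i, Pos) > 0" "(i, Pos) \<in> V"
        using i \<open>\<phi> a x > 0\<close> by (simp_all add: w_def signed_def V_def)
      then show ?thesis
        unfolding Z_def using finV w_nonneg[OF that] by (intro sum_pos2) auto
    qed
    have Z_neg: "Z (\<lambda>i. - x i) = Z x" for x
      unfolding Z_def w_neg
      by (rule sum.reindex_bij_witness[of _ flip flip]) (auto simp: V_def flip_def)
    define f where "f x v = w x v / Z x" for x v
    have f_supp: "{v. f x v \<noteq> 0} = {v. w x v > 0}" if "x \<in> S" for x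
      using Z_pos[OF that] w_nonneg[OF that] by (auto simp: f_def less_le)
    have "continuous_map (nsphere d) (powertop_real UNIV) f"
      unfolding continuous_map_componentwise_UNIV f_def Z_def
    proof (intro allI continuous_map_real_divide w_cont continuous_map_sum finV)
      fix x assume "x \<in> topspace (nsphere d)"
      then show "sum (w x) V \<noteq> 0"
        using Z_pos[of x] by (simp add: Z_def S_def)
    qed
    moreover have "f x \<in> {x. (\<forall>v. 0 \<le> x v) \<and> {v. x v \<noteq> 0} \<in> sign_complex A \<and>
        (\<Sum>v | x v \<noteq> 0. x v) = 1}" if x: "x \<in> S" for x
    proof -
      have "0 \<le> f x v" for v
        using Z_pos[OF x] w_nonneg[OF x] by (simp add: f_def)
      moreover have "{v. f x v \<noteq> 0} \<in> sign_complex A"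
      proof -
        obtain r where r: "r < length xs" "\<forall>i<N. A $$ (r, i) = pat x i"
          using row_of_point[OF x] by blast
        have "v \<in> row_plus A r" if "w x v > 0" for v
        proof -
          obtain i s where v: "v = (i, s)" by fastforce
          have "i < N" "pat x i = Some s"
            using that v x by (auto simp: w_def pat split: if_splits)
          then show ?thesis
            using r v by (cases s) (auto simp: row_plus_def A)
        qed
        then show ?thesis
          unfolding f_supp[OF x] sign_complex_def using r by (auto simp: A)
      qed
      moreover have "(\<Sum>v | f x v \<noteq> 0. f x v) = 1"
      proof -
        have "{v. f x v \<noteq> 0} \<subseteq> V"
          by (auto simp: f_def w_def V_def split: if_splits)
        then have "(\<Sum>v | f x v \<noteq> 0. f x v) = (\<Sum>v\<in>V. f x v)"
          by (intro sum.mono_neutral_left finV) auto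
        also have "\<dots> = 1"
          using Z_pos[OF x] by (simp add: f_def Z_def flip: sum_divide_distrib)
        finally show ?thesis .
      qed
      ultimately show ?thesis by simp
    qed
    ultimately have "continuous_map (nsphere d) (realization (sign_complex A)) f"
      by (auto simp: realization_def continuous_map_in_subtopology S_def)
    moreover have "f (\<lambda>i. - x i) = f x \<circ> flip" for x
      by (auto simp: f_def w_neg Z_neg)
    ultimately show ?thesis
      unfolding equivariant_sphere_map_def by blast
  qed
  then have "coind (sign_complex A) flip \<ge> ereal (real d)"
    unfolding coind_def by (auto intro: SUP_upper)
  ultimately show ?thesis
    using A N_def by blast
qed

section \<open>Functions that separate antipodal points\<close>

definition block_norm :: "nat \<Rightarrow> nat \<Rightarrow> (nat \<Rightarrow> real) \<Rightarrow> real" where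
  "block_norm k b x = (\<Sum>j<k. \<bar>x (b * k + j)\<bar>)"

text \<open>Signs are the reals \<open>-1\<close> and \<open>1\<close>, so that "the coordinate \<open>t\<close> has sign \<open>s\<close> and is not tiny"
  is the open condition \<open>s * t > \<beta>\<close>. Both \<open>g\<close> and \<open>h\<close> are total: instead of leaving out the
  coordinates and blocks on which nothing should be recorded, the functions below
  ignore the values there. This keeps the counting a product.\<close>

definition labels :: "nat \<Rightarrow> nat \<Rightarrow> (nat \<times> (nat \<Rightarrow> real) \<times> (nat \<Rightarrow> nat \<times> real)) set" where
  "labels r k = {..<r} \<times> ({..<k} \<rightarrow>\<^sub>E {-1, 1}) \<times> ({..<r} \<rightarrow>\<^sub>E {..<k} \<times> {-1, 1})"

lemma finite_labels: "finite (labels r k)"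
  by (auto simp: labels_def intro!: finite_PiE)

lemma card_labels: "card (labels r k) = r * 2 ^ k * (2 * k) ^ r"
proof -
  have "card {-1, 1 :: real} = 2"
    by simp
  then show ?thesis
    by (simp only: labels_def card_cartesian_product card_PiE finite_lessThan prod_constant
        card_lessThan mult.commute mult.left_commute)
qed

text \<open>Each factor is the positive part of a continuous function, and its positivity expresses one of the
  conditions in \<open>bump_pos_iff\<close>. A block counts as small if its norm is below \<open>\<gamma>\<close>, a coordinate as
  tiny if its absolute value is at most \<open>\<beta>\<close>.\<close>

definition bump ::
  "nat \<Rightarrow> nat \<Rightarrow> real \<Rightarrow> real \<Rightarrow> nat \<times> (nat \<Rightarrow> real) \<times> (nat \<Rightarrow> nat \<times> real) \<Rightarrow> (nat \<Rightarrow> real) \<Rightarrow> real"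
  where
  "bump r k \<beta> \<gamma> = (\<lambda>(b, g, h) x.
     max 0 (block_norm k b x - \<gamma>) *
     (\<Prod>j<k. max 0 (g j * x (b * k + j) + \<beta>)) *
     (\<Prod>c<r. max 0 (max (snd (h c) * x (c * k + fst (h c)) - \<beta>) (\<gamma> - block_norm k c x))))"

lemma bump_nonneg: "0 \<le> bump r k \<beta> \<gamma> a x"
  by (cases a) (auto simp: bump_def intro!: mult_nonneg_nonneg prod_nonneg)

lemma bump_pos_iff:
  "bump r k \<beta> \<gamma> (b, g, h) x > 0 \<longleftrightarrow>
     block_norm k b x > \<gamma> \<and>
     (\<forall>j<k. g j * x (b * k + j) > - \<beta>) \<and>
     (\<forall>c<r. snd (h c) * x (c * k + fst (h c)) > \<beta> \<or> block_norm k c x < \<gamma>)"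
proof -
  have prod: "(\<Prod>i<n. max 0 (F i)) > 0 \<longleftrightarrow> (\<forall>i<n. F i > 0)" for n :: nat and F :: "nat \<Rightarrow> real"
  proof -
    have "(\<Prod>i<n. max 0 (F i)) \<ge> 0"
      by (simp add: prod_nonneg)
    then have "(\<Prod>i<n. max 0 (F i)) > 0 \<longleftrightarrow> (\<Prod>i<n. max 0 (F i)) \<noteq> 0"
      by linarith
    then show ?thesis
      by (force simp: max_def less_le split: if_splits)
  qed
  have mult: "u * v > 0 \<longleftrightarrow> u > 0 \<and> v > 0" if "u \<ge> 0" "v \<ge> 0" for u v :: real
    using that by (auto simp: zero_less_mult_iff)
  show ?thesis
    unfolding bump_def prod.case
    by (subst mult mult prod prod; (simp add: prod_nonneg)?)+
       (auto simp: less_max_iff_disj neg_less_iff_less less_diff_eq)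
qed

lemma continuous_bump: "continuous_on UNIV (bump r k \<beta> \<gamma> a)"
proof -
  obtain b g h where a: "a = (b, g, h)" by (cases a)
  have [continuous_intros]: "continuous_on UNIV (\<lambda>x::nat \<Rightarrow> real. x i)" for i
    by (rule continuous_on_product_coordinates)
  show ?thesis
    unfolding a bump_def block_norm_def prod.case by (intro continuous_intros)
qed

lemma continuous_map_nsphere:
  "continuous_on UNIV f \<Longrightarrow> continuous_map (nsphere d) euclideanreal f"
  by (auto simp: nsphere euclidean_product_topology intro: continuous_on_subset)

text \<open>Since \<open>a\<close> is active, block \<open>b\<close> has norm greater than \<open>\<gamma>\<close>, so \<open>a'\<close> cannot treat it as small and
  has to choose a coordinate of it that exceeds \<open>\<beta>\<close> in absolute value. There a wrong sign of \<open>g\<close>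
  would violate the bound \<open>- \<beta>\<close>.\<close>

lemma bump_agree:
  assumes "a = (b, g, h)" "a' = (b', g', h')" "a \<in> labels r k" "a' \<in> labels r k"
    and pos: "bump r k \<beta> \<gamma> a x > 0" "bump r k \<beta> \<gamma> a' x > 0"
  shows "g (fst (h' b)) = snd (h' b)"
proof -
  let ?j = "fst (h' b)" and ?s = "snd (h' b)"
  have b: "b < r" and g: "\<And>j. j < k \<Longrightarrow> g j \<in> {-1, 1}" and "h' b \<in> {..<k} \<times> {-1, 1}"
    using assms by (auto simp: labels_def PiE_iff)
  then have j: "?j < k" and s: "?s \<in> {-1, 1}"
    by auto
  have *: "?s * x (b * k + ?j) > \<beta>"
    using pos b assms(1,2) by (fastforce simp: bump_pos_iff)
  have "g ?j * x (b * k + ?j) > - \<beta>"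
    using pos j assms(1) by (simp add: bump_pos_iff)
  then show "g ?j = ?s"
    using * g[OF j] s by auto
qed

text \<open>Block \<open>b\<close> is not small at \<open>y\<close>, where \<open>a\<close> is active, so the coordinate of block \<open>b\<close> that \<open>a'\<close> chooses
  is not tiny in \<open>- y\<close> and has there the chosen sign. By \<open>bump_agree\<close> at \<open>x\<close> this is also the sign
  recorded by \<open>g\<close>, which is therefore wrong at a coordinate of \<open>y\<close> that is not tiny.\<close>

lemma bump_separated:
  assumes "a \<in> labels r k" "a' \<in> labels r k"
    and "bump r k \<beta> \<gamma> a x > 0" "bump r k \<beta> \<gamma> a' x > 0"
    and "bump r k \<beta> \<gamma> a y > 0" "bump r k \<beta> \<gamma> a' (\<lambda>i. - y i) > 0"
  shows False
proof -
  obtain b g h where a: "a = (b, g, h)" by (cases a)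
  obtain b' g' h' where a': "a' = (b', g', h')" by (cases a')
  let ?j = "fst (h' b)" and ?s = "snd (h' b)"
  have "h' b \<in> {..<k} \<times> {-1, 1}" "b < r"
    using assms a a' by (auto simp: labels_def PiE_iff)
  then have "?j < k" by auto
  have "block_norm k b (\<lambda>i. - y i) = block_norm k b y"
    by (simp add: block_norm_def)
  then have "?s * (- y (b * k + ?j)) > \<beta>"
    using assms(5,6) \<open>b < r\<close> a a' by (fastforce simp: bump_pos_iff)
  moreover have "g ?j * y (b * k + ?j) > - \<beta>"
    using assms(5) a \<open>?j < k\<close> by (simp add: bump_pos_iff)
  moreover have "g ?j = ?s"
    using bump_agree[OF a a' assms(1-4)] .
  ultimately show False
    by simp
qed

text \<open>The 1-norm of a unit vector is at least 1, so some block has norm at least \<open>1 / r > \<gamma>\<close>; this gives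
  \<open>b\<close>. A block of norm at least \<open>\<gamma>\<close> has a coordinate greater than \<open>\<beta>\<close> in absolute value because
  \<open>k * \<beta> < \<gamma>\<close>; this gives \<open>h\<close>.\<close>

lemma bump_cover:
  assumes r: "r > 0" and k: "k > 0"
    and \<gamma>: "\<gamma> < 1 / real r" and \<beta>: "0 < \<beta>" "real k * \<beta> < \<gamma>"
    and x: "x \<in> topspace (nsphere (r * k - 1))"
  shows "\<exists>a\<in>labels r k. bump r k \<beta> \<gamma> a x > 0"
proof -
  have rk: "r * k > 0"
    using r k by simp
  then have "{..r * k - 1} = {..<r * k}"
    by (simp flip: lessThan_Suc_atMost)
  then have one: "(\<Sum>i<r * k. (x i)\<^sup>2) = 1"
    using x by (simp add: nsphere)
  have "\<bar>x i\<bar> \<le> 1" if "i < r * k" for i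
  proof -
    have "(x i)\<^sup>2 \<le> (\<Sum>i<r * k. (x i)\<^sup>2)"
      using that by (intro member_le_sum) auto
    then show ?thesis
      by (simp add: one abs_square_le_1)
  qed
  then have "(x i)\<^sup>2 \<le> \<bar>x i\<bar>" if "i < r * k" for i
    using that mult_left_le[of "\<bar>x i\<bar>" "\<bar>x i\<bar>"] by (simp add: power2_eq_square)
  then have "1 \<le> (\<Sum>i<r * k. \<bar>x i\<bar>)"
    unfolding one[symmetric] by (intro sum_mono) auto
  also have "\<dots> = (\<Sum>b<r. sum (\<lambda>i. \<bar>x i\<bar>) {b * k..<b * k + k})"
    by (rule sum.nat_group[symmetric])
  also have "\<dots> = (\<Sum>b<r. block_norm k b x)"
  proof (intro sum.cong refl)
    fix b
    show "sum (\<lambda>i. \<bar>x i\<bar>) {b * k..<b * k + k} = block_norm k b x"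
      unfolding block_norm_def
      by (rule sum.reindex_bij_witness[of _ "\<lambda>j. b * k + j" "\<lambda>i. i - b * k"]) auto
  qed
  finally have total: "1 \<le> (\<Sum>b<r. block_norm k b x)" .
  have "\<exists>b<r. block_norm k b x > \<gamma>"
  proof (rule ccontr)
    assume "\<not> ?thesis"
    then have "\<And>b. b < r \<Longrightarrow> block_norm k b x \<le> \<gamma>"
      by (metis not_less)
    then have "(\<Sum>b<r. block_norm k b x) \<le> real r * \<gamma>"
      using sum_bounded_above[of "{..<r}" "\<lambda>b. block_norm k b x" \<gamma>] by simp
    also have "\<dots> < 1"
      using \<gamma> r by (simp add: field_simps)
    finally show False
      using total by simp
  qed
  then obtain b where b: "b < r" "block_norm k b x > \<gamma>" by blast
  define sg where "sg t = (if t < 0 then -1 else 1 :: real)" for t :: real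
  have sg: "sg t \<in> {-1, 1}" "sg t * t = \<bar>t\<bar>" for t
    by (auto simp: sg_def)
  define g where "g = (\<lambda>j\<in>{..<k}. sg (x (b * k + j)))"
  have big: "\<exists>j<k. \<bar>x (c * k + j)\<bar> > \<beta> \<or> block_norm k c x < \<gamma>" for c
  proof (rule ccontr)
    assume *: "\<not> ?thesis"
    then have "\<gamma> \<le> block_norm k c x"
      using k by force
    also have "\<dots> \<le> real k * \<beta>"
      unfolding block_norm_def
      using * sum_bounded_above[of "{..<k}" "\<lambda>j. \<bar>x (c * k + j)\<bar>" \<beta>] by force
    finally show False
      using \<beta> by simp
  qed
  then obtain J where J: "\<And>c. J c < k"
    "\<And>c. \<bar>x (c * k + J c)\<bar> > \<beta> \<or> block_norm k c x < \<gamma>"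
    by metis
  define h where "h = (\<lambda>c\<in>{..<r}. (J c, sg (x (c * k + J c))))"
  have "(b, g, h) \<in> labels r k"
    using b sg(1) J(1) unfolding labels_def g_def h_def by auto
  moreover have "bump r k \<beta> \<gamma> (b, g, h) x > 0"
    unfolding bump_pos_iff
  proof (intro conjI allI impI)
    fix j assume "j < k"
    then have "g j * x (b * k + j) = \<bar>x (b * k + j)\<bar>"
      by (simp add: g_def sg)
    then show "- \<beta> < g j * x (b * k + j)"
      using \<beta>(1) abs_ge_zero[of "x (b * k + j)"] by linarith
  next
    fix c assume "c < r"
    then show "\<beta> < snd (h c) * x (c * k + fst (h c)) \<or> block_norm k c x < \<gamma>"
      using J(2)[of c] by (simp add: h_def sg)
  qed (use b in simp)
  ultimately show ?thesis by blast
qed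

lemma sign_matrix_from_blocks:
  assumes r: "r > 0" and k: "k > 0"
  shows "\<exists>M (A :: sign option mat). A \<in> carrier_mat M (r * 2 ^ k * (2 * k) ^ r) \<and> VC A = 1 \<and>
           coind (sign_complex A) flip \<ge> ereal (real (r * k - 1))"
proof -
  define \<gamma> where "\<gamma> = 1 / (2 * real r)"
  define \<beta> where "\<beta> = \<gamma> / (2 * real k)"
  have \<gamma>: "0 < \<gamma>" "\<gamma> < 1 / real r"
    using r by (simp_all add: \<gamma>_def field_simps)
  have \<beta>: "0 < \<beta>" "real k * \<beta> < \<gamma>"
    using k \<gamma> by (simp_all add: \<beta>_def field_simps)
  show ?thesis
    unfolding card_labels[symmetric]
  proof (rule partial_sign_matrix_of_sphere_cover[where \<phi> = "bump r k \<beta> \<gamma>"])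
    show "\<exists>a\<in>labels r k. bump r k \<beta> \<gamma> a x > 0" if "x \<in> topspace (nsphere (r * k - 1))" for x
      using bump_cover[OF r k \<gamma>(2) \<beta> that] .
  qed (use bump_separated in
      \<open>auto simp: finite_labels bump_nonneg intro: continuous_map_nsphere continuous_bump\<close>)
qed

section \<open>Choice of the number and length of the blocks\<close>

text \<open>The number of columns for \<open>r = 2 ^ p\<close> blocks of length \<open>k = p * 2 ^ p\<close>, so that \<open>r * k = p * 4 ^ p\<close>.\<close>

lemma ln_column_count_bounds:
  fixes p :: nat
  assumes p: "p \<ge> 2"
  defines "N \<equiv> 2 ^ p * 2 ^ (p * 2 ^ p) * (2 * (p * 2 ^ p)) ^ (2 ^ p) :: nat"
  shows "ln (real N) \<le> 5 * (real p * 2 ^ p)" and "ln (ln (real N)) \<ge> real p / 2"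
proof -
  let ?q = "2 ^ p :: real"
  have "1 \<le> ln (2 ^ 2 :: real)"
    using exp_le by (subst ln_ge_iff) auto
  then have ln2: "1 / 2 \<le> ln (2::real)" "ln (2::real) \<le> 1"
    using ln_2_less_1 by (simp_all only: ln_realpow)
  have q: "?q \<ge> 1" "real p \<ge> 2"
    using p by auto
  have lnp: "0 \<le> ln (real p)" "ln (real p) \<le> real p"
    using p by (auto intro!: ln_ge_zero less_imp_le[OF ln_less_self])
  have lnN: "ln (real N) = real p * ln 2 + real p * ?q * ln 2 + ?q * (ln 2 + ln (real p) + real p * ln 2)"
    using p by (simp add: N_def ln_mult ln_realpow algebra_simps)
  have "real p * ln 2 \<le> real p * ?q"
    using ln2(2) q(1) by (intro mult_left_mono) linarith+
  moreover have "real p * ?q * ln 2 \<le> real p * ?q"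
    using ln2 q by (intro mult_left_le) auto
  moreover have "?q * (ln 2 + ln (real p) + real p * ln 2) \<le> ?q * (3 * real p)"
  proof (intro mult_left_mono)
    have "real p * ln 2 \<le> real p"
      using ln2 q by (intro mult_left_le) auto
    then show "ln 2 + ln (real p) + real p * ln 2 \<le> 3 * real p"
      using ln2 lnp q by linarith
  qed simp
  ultimately show "ln (real N) \<le> 5 * (real p * ?q)"
    unfolding lnN by (simp add: algebra_simps)
  have "real p * ?q * ln 2 \<ge> 2 * ?q * (1 / 2)"
    using ln2 q by (intro mult_mono) auto
  moreover have "real p * ln 2 \<ge> 0" "?q * (ln 2 + ln (real p) + real p * ln 2) \<ge> 0"
    using ln2 lnp q by auto
  ultimately have "ln (real N) \<ge> ?q"
    unfolding lnN by linarith
  then have "ln (ln (real N)) \<ge> ln ?q"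
    using q(1) by (subst ln_le_cancel_iff) linarith+
  moreover have "ln ?q = real p * ln 2"
    by (simp add: ln_realpow)
  moreover have "real p * ln 2 \<ge> real p * (1 / 2)"
    using ln2 by (intro mult_left_mono) auto
  ultimately show "ln (ln (real N)) \<ge> real p / 2"
    by linarith
qed

theorem proposition8:
  shows "\<exists>c::real. c > 0 \<and>
    (\<forall>N0::nat. \<exists>N\<ge>N0. \<exists>(M::nat) (A :: sign option mat).
       A \<in> carrier_mat M N \<and> VC A = 1 \<and>
       coind (sign_complex A) flip \<ge> ereal (c * ((ln (real N))\<^sup>2 / ln (ln (real N)))))"
proof (rule exI[of _ "1 / 100"], intro conjI allI)
  (* The bounds on the logarithms give a quotient of at most (5 p 2^p)^2 / (p/2) = 50 r k, and
     r k - 1 is at least half of r k. *)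
  show "(1 / 100 :: real) > 0" by simp
  fix N0 :: nat
  define p where "p = max N0 2"
  have p: "p \<ge> 2" "p \<ge> N0"
    by (auto simp: p_def)
  define r k N where "r = (2::nat) ^ p" and "k = p * r" and "N = r * 2 ^ k * (2 * k) ^ r"
  have rk: "r > 0" "k > 0"
    using p by (auto simp: r_def k_def)
  obtain M and A :: "sign option mat" where A: "A \<in> carrier_mat M N" "VC A = 1"
    "coind (sign_complex A) flip \<ge> ereal (real (r * k - 1))"
    using sign_matrix_from_blocks[OF rk] unfolding N_def by blast
  have "N0 \<le> r"
    using p(2) less_exp[of p] unfolding r_def by linarith
  also have "r \<le> N"
    using rk by (simp add: N_def)
  finally have "N0 \<le> N" .
  moreover have "1 / 100 * ((ln (real N))\<^sup>2 / ln (ln (real N))) \<le> real (r * k - 1)"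
  proof -
    note bounds = ln_column_count_bounds[OF p(1), folded r_def, folded k_def, folded N_def]
    have "ln (real N) \<ge> 0"
      using \<open>r \<le> N\<close> rk by (intro ln_ge_zero) auto
    then have "(ln (real N))\<^sup>2 \<le> (5 * (real p * real r))\<^sup>2"
      using bounds(1) by (intro power_mono) (auto simp: r_def)
    then have "(ln (real N))\<^sup>2 / ln (ln (real N)) \<le> (5 * (real p * real r))\<^sup>2 / (real p / 2)"
      using bounds(2) p by (intro frac_le) auto
    also have "\<dots> = 50 * (real r * real k)"
      using p by (simp add: k_def power2_eq_square field_simps)
    finally have "1 / 100 * ((ln (real N))\<^sup>2 / ln (ln (real N))) \<le> real (r * k) / 2"
      by simp
    also have "\<dots> \<le> real (r * k - 1)"
    proof -
      have "2 * 1 \<le> k * r"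
        using p rk mult_le_mono[of 2 p 1 r] mult_le_mono[of 2 k 1 r] by (simp add: k_def)
      then have "r * k \<le> 2 * (r * k - 1)"
        by (simp add: mult.commute)
      then have "real (r * k) \<le> real (2 * (r * k - 1))"
        by (simp only: of_nat_le_iff)
      then show ?thesis
        by simp
    qed
    finally show ?thesis .
  qed
  then have "ereal (1 / 100 * ((ln (real N))\<^sup>2 / ln (ln (real N)))) \<le> coind (sign_complex A) flip"
    using A(3) by (meson ereal_less_eq(3) order_trans)
  ultimately show "\<exists>N\<ge>N0. \<exists>M (A :: sign option mat). A \<in> carrier_mat M N \<and> VC A = 1 \<and>
      coind (sign_complex A) flip \<ge> ereal (1 / 100 * ((ln (real N))\<^sup>2 / ln (ln (real N))))"
    using A(1,2) by blast
qed

end
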